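(* Let $n\geq 2$ and let $G\subset\mathbb{R}^n$ be an unbounded open convex set that does not contain a translation of a cone with non-empty interior. Let $\alpha\in(0,1)$ and set $\omega(t):=t^{\alpha}$ for all $t\geq 0$. Then there exists a Fréchet differentiable $f:G\to\mathbb{R}$ such that: (i) for every $a\in G$ and $v\in\mathbb{R}^n$ with $|v|=1$, the derivative of the function $t\mapsto f(a+tv)$ is uniformly continuous on $\{t\in\mathbb{R}:a+tv\in G\}$ with modulus $\omega$; (ii) $|f(x+h)-f(x)-f'(x)[h]|\leq|h|^{1+\alpha}$ for all $x,h\in\mathbb{R}^n$ with $x,x+h\in G$; (iii) $f\notin C^{1,\alpha}(G)$.
   Context: The norm $|\cdot|$ on $\mathbb{R}^n$ is Euclidean. A cone in $\mathbb{R}^n$ is a set $C\subset\mathbb{R}^n$ such that $\lambda x\in C$ for each $x\in C$ and $\lambda>0$. $f'(x)$ denotes the Fréchet derivative of $f$ at $x$ and $f'(x)[h]$ its evaluation at $h$. A function $g$ is uniformly continuous with modulus $\omega$ on a set $A$ if $|g(s)-g(t)|\leq\omega(|s-t|)$ for all $s,t\in A$. $C^{1,\alpha}(G)$ is the set of all Fréchet differentiable $f:G\to\mathbb{R}$ for which there is $C>0$ with $|f'(x)-f'(y)|\leq C|x-y|^{\alpha}$ for all $x,y\in G$. *)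

theory Defs
  imports "HOL-Analysis.Analysis"
begin

text \<open>
  The library's \<^const>\<open>cone\<close> asks for closure under all scalars \<open>c \<ge> 0\<close>, which forces a nonempty
  cone to contain the origin. Here only strictly positive scalars are used.
\<close>

definition pos_cone :: "'a::real_vector set \<Rightarrow> bool"
  where "pos_cone C \<longleftrightarrow> (\<forall>x\<in>C. \<forall>c>0. c *\<^sub>R x \<in> C)"

definition contains_translated_fat_cone :: "'a::real_normed_vector set \<Rightarrow> bool"
  where "contains_translated_fat_cone G \<longleftrightarrow>
    (\<exists>C z. pos_cone C \<and> interior C \<noteq> {} \<and> (\<lambda>x. z + x) ` C \<subseteq> G)"

definition uniformly_continuous_with_modulus ::
    "(real \<Rightarrow> real) \<Rightarrow> 'a::real_normed_vector set \<Rightarrow> ('a \<Rightarrow> 'b::real_normed_vector) \<Rightarrow> bool"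
  where "uniformly_continuous_with_modulus \<omega> A g \<longleftrightarrow>
    (\<forall>s\<in>A. \<forall>t\<in>A. norm (g s - g t) \<le> \<omega> (norm (s - t)))"

text \<open>
  A function \<open>G \<rightarrow> \<real>\<close> is represented by a total function whose values outside \<open>G\<close> are irrelevant;
  this is sound for open \<open>G\<close>, where the derivative at a point of \<open>G\<close> depends only on the values in \<open>G\<close>.
  The distance of two derivatives is taken in the operator norm.
\<close>

definition C1_Holder :: "real \<Rightarrow> 'a::real_normed_vector set \<Rightarrow> ('a \<Rightarrow> real) set"
  where "C1_Holder \<alpha> G = {f. (\<forall>x\<in>G. f differentiable at x) \<and>
    (\<exists>C>0. \<forall>x\<in>G. \<forall>y\<in>G.
       onorm (\<lambda>h. frechet_derivative f (at x) h - frechet_derivative f (at y) h)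
         \<le> C * norm (x - y) powr \<alpha>)}"

end

theory Submission
  imports Defs
begin

text \<open>
  Hoelder continuity of \<open>t \<mapsto> f' (a + t v) [v]\<close> along lines controls only the derivative in the direction
  of travel. In a thin set the component of \<open>f'\<close> across the set is hardly seen by lines: those
  transversal to the set are short, and the long ones are almost orthogonal to the thin direction.
  The construction makes this component vary too fast.

  Without a translated fat cone the set \<open>G\<close> is thin at infinity: there is a unit vector \<open>w\<close> such that
  \<open>\<bar>w \<bullet> x\<bar> = o(\<bar>x\<bar>)\<close> for \<open>x \<in> G\<close> (\<open>thin_direction\<close>). Consider \<open>F z = (w \<bullet> z) * \<bar>z\<bar>\<^sup>2 / (1 + \<bar>z\<bar>\<^sup>2)\<close>. On a
  set of relative width \<open>1 / M\<close>, in the sense that \<open>M * \<bar>w \<bullet> z\<bar> \<le> max \<bar>z\<bar> 1\<close>, the derivative of \<open>F\<close> in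
  the direction of a segment of length \<open>l\<close> oscillates between its ends by at most \<open>8 * min (1 / M) l \<le> 8 * M powr (\<alpha> - 1) * l powr \<alpha>\<close>
  (\<open>profile_deriv_oscillation\<close>), whereas the derivative of \<open>F\<close> in direction \<open>w\<close> rises from \<open>0\<close> at the origin
  to at least \<open>1/2\<close> on the unit sphere. Thus a large \<open>M\<close>, which is available after rescaling by a
  large \<open>R\<close>, makes the full Hoelder constant large compared with the directional one.

  The function is \<open>f x = (\<Sum>k. c k * R k * F (x / R k))\<close> with \<open>c k\<close> proportional to
  \<open>2 ^ k * R k powr \<alpha>\<close>, where \<open>R k\<close> is so large that the relative width on the scale \<open>R k\<close> is at most
  \<open>1 / M k\<close> with \<open>M k powr (1 - \<alpha>) = 4 ^ k\<close>. The directional constants of the layers are then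
  proportional to \<open>2 powr (- k)\<close> and sum to \<open>1\<close> (\<open>layered_directionally_Hoelder\<close>), and the bound on the
  Taylor remainder follows by the mean value theorem. All layers have nonnegative derivative
  in direction \<open>w\<close>, so on the sphere of radius \<open>R k\<close> the derivative of \<open>f\<close> in this direction is at
  least \<open>c k / 2\<close>; as \<open>c k\<close> outgrows \<open>R k powr \<alpha>\<close>, these values rule out every Hoelder constant for the full derivative (\<open>layered_not_C1_Hoelder\<close>).
\<close>

section \<open>The direction in which the set is thin\<close>

text \<open>
  Since \<open>G\<close> is open and convex, every limit of directions \<open>x / \<bar>x\<bar>\<close> with \<open>x \<in> G\<close> going to infinity is
  the direction of a ray in \<open>G\<close> from any chosen point \<open>a\<close>. The directions of such rays form a convex
  cone, which has empty interior because \<open>G\<close> contains no translated fat cone; so they all lie in a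
  hyperplane, and \<open>w\<close> is its unit normal. Hence \<open>\<bar>w \<bullet> x\<bar> = o(\<bar>x\<bar>)\<close> on \<open>G\<close>. The form with
  \<open>max \<bar>x\<bar> R\<close> covers the points near the origin too and says that on the scale \<open>R\<close> and on all
  larger ones \<open>\<bar>w \<bullet> x\<bar>\<close> is at most \<open>1 / M\<close> times the scale.
\<close>

lemma thin_direction:
  fixes G :: "'a::euclidean_space set"
  assumes "G \<noteq> {}" "open G" "convex G" and nocone: "\<not> contains_translated_fat_cone G"
  obtains w where "norm w = 1"
    "\<And>M::real. \<exists>R. \<forall>x\<in>G. M * \<bar>w \<bullet> x\<bar> \<le> max (norm x) R"
proof -
  obtain a where a: "a \<in> G" using assms by blast
  define K where "K = {u. \<forall>t\<ge>0. a + t *\<^sub>R u \<in> G}"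
  have "pos_cone K"
    unfolding pos_cone_def K_def by (auto simp: scaleR_scaleR)
  moreover have "(\<lambda>x. a + x) ` K \<subseteq> G"
  proof clarify
    fix u assume "u \<in> K"
    then show "a + u \<in> G" unfolding K_def by (auto dest: spec[of _ 1])
  qed
  ultimately have "interior K = {}"
    using nocone unfolding contains_translated_fat_cone_def by blast
  moreover have "convex K"
  proof (rule convexI)
    fix u v :: 'a and p q :: real
    assume *: "u \<in> K" "v \<in> K" "0 \<le> p" "0 \<le> q" "p + q = 1"
    show "p *\<^sub>R u + q *\<^sub>R v \<in> K"
      unfolding K_def
    proof safe
      fix t :: real assume "t \<ge> 0"
      then have "p *\<^sub>R (a + t *\<^sub>R u) + q *\<^sub>R (a + t *\<^sub>R v) \<in> G"
        using * \<open>convex G\<close> unfolding K_def by (auto intro: convexD)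
      moreover have "p *\<^sub>R (a + t *\<^sub>R u) + q *\<^sub>R (a + t *\<^sub>R v)
          = (p + q) *\<^sub>R a + t *\<^sub>R (p *\<^sub>R u + q *\<^sub>R v)"
        by (simp add: algebra_simps)
      ultimately show "a + t *\<^sub>R (p *\<^sub>R u + q *\<^sub>R v) \<in> G"
        using * by simp
    qed
  qed
  ultimately obtain n b where n: "n \<noteq> 0" "K \<subseteq> {x. n \<bullet> x = b}"
    using empty_interior_subset_hyperplane by metis
  have "0 \<in> K" using a by (simp add: K_def)
  then have "b = 0" using n(2) by auto
  then have K0: "n \<bullet> u = 0" if "u \<in> K" for u using n(2) that by auto
  define w where "w = n /\<^sub>R norm n"
  have w: "norm w = 1" using n by (simp add: w_def)
  have Kw: "w \<bullet> u = 0" if "u \<in> K" for u using K0[OF that] by (simp add: w_def)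
  have "\<exists>R. \<forall>x\<in>G. M * \<bar>w \<bullet> x\<bar> \<le> max (norm x) R" for M :: real
  proof (rule ccontr)
    assume "\<not> ?thesis"
    then have "\<forall>k::nat. \<exists>x\<in>G. M * \<bar>w \<bullet> x\<bar> > max (norm x) (real k)"
      by (meson not_le)
    then obtain x where x: "\<And>k::nat. x k \<in> G" "\<And>k. M * \<bar>w \<bullet> x k\<bar> > max (norm (x k)) (real k)"
      by metis
    have "M > 0"
    proof (rule ccontr)
      assume "\<not> M > 0"
      then have "M * \<bar>w \<bullet> x 0\<bar> \<le> 0" by (simp add: mult_nonpos_nonneg)
      with x(2)[of 0] show False by (smt (verit) norm_ge_zero)
    qed
    have big: "real k \<le> M * norm (x k)" for k
    proof -
      have "\<bar>w \<bullet> x k\<bar> \<le> norm (x k)" using Cauchy_Schwarz_ineq2[of w "x k"] w by simp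
      then have "M * \<bar>w \<bullet> x k\<bar> \<le> M * norm (x k)" using \<open>M > 0\<close> by simp
      with x(2)[of k] show ?thesis by linarith
    qed
    (* A violating sequence must escape to infinity, since |x k| >= k / M. *)
    have lim: "filterlim (\<lambda>k. norm (x k)) at_top sequentially"
    proof -
      have "filterlim (\<lambda>k. inverse M * real k) at_top sequentially"
        using \<open>M > 0\<close>
        by (intro filterlim_tendsto_pos_mult_at_top[OF tendsto_const _ filterlim_real_sequentially]) simp
      then show ?thesis
        by (rule filterlim_at_top_mono) (use big \<open>M > 0\<close> in \<open>auto simp: field_simps\<close>)
    qed
    define s where "s = (\<lambda>k. x k /\<^sub>R norm (x k))"
    have "s k \<in> cball 0 1" for k by (cases "x k = 0") (simp_all add: s_def)
    then obtain u r where r: "strict_mono (r :: nat \<Rightarrow> nat)" "(s \<circ> r) \<longlonglongrightarrow> u"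
      using compact_cball[of "0::'a" 1] unfolding compact_def by metis
    have lim': "filterlim (\<lambda>k. norm (x (r k))) at_top sequentially"
      using filterlim_compose[OF lim filterlim_subseq[OF r(1)]] by simp
    (* Points on the segments from a to x (r k), at distance about t from a. *)
    have cl: "a + t *\<^sub>R u \<in> closure G" if "t \<ge> 0" for t
    proof -
      have "(\<lambda>k. (1 - t / norm (x (r k))) *\<^sub>R a + t *\<^sub>R (s \<circ> r) k) \<longlonglongrightarrow> (1 - 0) *\<^sub>R a + t *\<^sub>R u"
        by (intro tendsto_intros r(2) real_tendsto_divide_at_top[OF tendsto_const lim'])
      moreover have "\<forall>\<^sub>F k in sequentially. norm (x (r k)) \<ge> max t 1"
        using lim' unfolding filterlim_at_top by blast
      then have "\<forall>\<^sub>F k in sequentially. (1 - t / norm (x (r k))) *\<^sub>R a + t *\<^sub>R (s \<circ> r) k \<in> closure G"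
      proof eventually_elim
        case (elim k)
        then have pos: "norm (x (r k)) > 0" and "t \<le> norm (x (r k))" by linarith+
        then have "t / norm (x (r k)) \<le> 1" by (simp only: pos_divide_le_eq mult_1)
        moreover have "0 \<le> t / norm (x (r k))" using that pos by simp
        ultimately have "(1 - t / norm (x (r k))) *\<^sub>R a + (t / norm (x (r k))) *\<^sub>R x (r k) \<in> G"
          by (intro convexD[OF \<open>convex G\<close> a x(1)]) linarith+
        then show ?case
          using closure_subset[of G] by (auto simp: s_def divide_inverse)
      qed
      ultimately show ?thesis
        using Lim_in_closed_set[OF closed_closure] by fastforce
    qed
    (* A midpoint of the interior point a and a point of the closure is interior. *)
    have "u \<in> K"
      unfolding K_def
    proof safe
      fix t :: real assume "t \<ge> 0"
      have "(a + (2*t) *\<^sub>R u) - (1/2) *\<^sub>R ((a + (2*t) *\<^sub>R u) - a) \<in> interior G"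
        by (rule mem_interior_closure_convex_shrink)
          (use a assms cl[of "2*t"] \<open>t \<ge> 0\<close> in \<open>auto simp: interior_open\<close>)
      moreover have "(a + (2*t) *\<^sub>R u) - (1/2) *\<^sub>R ((a + (2*t) *\<^sub>R u) - a) = a + t *\<^sub>R u"
      proof -
        have "(2*t) *\<^sub>R u = t *\<^sub>R u + t *\<^sub>R u" by (simp flip: scaleR_left_distrib)
        then show ?thesis by simp
      qed
      ultimately show "a + t *\<^sub>R u \<in> G"
        using interior_subset by (metis subsetD)
    qed
    then have "w \<bullet> u = 0" by (rule Kw)
    moreover have "\<bar>w \<bullet> u\<bar> \<ge> 1 / M"
    proof (rule tendsto_lowerbound)
      show "(\<lambda>k. \<bar>w \<bullet> (s \<circ> r) k\<bar>) \<longlonglongrightarrow> \<bar>w \<bullet> u\<bar>"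
        by (intro tendsto_intros r(2))
      have "1 / M \<le> \<bar>w \<bullet> s k\<bar>" for k
      proof -
        have "x k \<noteq> 0" using x(2)[of k] by auto
        moreover have "norm (x k) \<le> M * \<bar>w \<bullet> x k\<bar>" using x(2)[of k] by linarith
        ultimately show ?thesis using \<open>M > 0\<close>
          by (simp add: s_def field_simps abs_mult)
      qed
      then show "\<forall>\<^sub>F k in sequentially. 1 / M \<le> \<bar>w \<bullet> (s \<circ> r) k\<bar>" by simp
    qed simp
    ultimately show False using \<open>M > 0\<close> by simp
  qed
  with w show ?thesis using that by blast
qed

section \<open>One layer at unit scale\<close>

text \<open>
  The derivative at \<open>z\<close>, in direction \<open>v\<close>, of \<open>z \<mapsto> (w \<bullet> z) * \<bar>z\<bar>\<^sup>2 / (1 + \<bar>z\<bar>\<^sup>2)\<close>. Its \<open>w\<close>-component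
  grows from \<open>0\<close> at the origin to at least \<open>1/2\<close> on the unit sphere.
\<close>

definition profile_deriv :: "'a::real_inner \<Rightarrow> 'a \<Rightarrow> 'a \<Rightarrow> real"
  where "profile_deriv w z v =
    (w \<bullet> v) * (1 - 1 / (1 + z \<bullet> z)) + 2 * (w \<bullet> z) * (z \<bullet> v) / (1 + z \<bullet> z)\<^sup>2"

lemma inverse_quadratic_bounds:
  fixes b :: real
  assumes "b \<ge> 0"
  defines "B \<equiv> 1 / (1 + b\<^sup>2)"
  shows "0 < B" "B \<le> 1" "2 * (b * B) \<le> 1" "max b 1 * B \<le> 1" "max b 1 * (b * B) \<le> 1"
proof -
  have p: "1 + b\<^sup>2 > 0" by (simp add: add_pos_nonneg)
  show "0 < B" using p by (simp add: B_def)
  show "B \<le> 1" using p by (simp add: B_def field_simps)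
  have q: "2 * b \<le> 1 + b\<^sup>2" using sum_squares_bound[of b 1] by simp
  then show "2 * (b * B) \<le> 1" using p by (simp add: B_def field_simps)
  have "max b 1 \<le> 1 + b\<^sup>2" "max b 1 * b \<le> 1 + b\<^sup>2"
    using q assms by (auto simp: max_def power2_eq_square)
  then show "max b 1 * B \<le> 1" "max b 1 * (b * B) \<le> 1"
    using p by (simp_all add: B_def field_simps)
qed

text \<open>
  The full derivative of the profile changes by a fixed amount between the origin and the unit sphere,
  but that change sits in the component along \<open>w\<close>. A line which stays in a set of relative width
  \<open>1 / M\<close> is either short or almost orthogonal to \<open>w\<close>: precisely, \<open>\<bar>l\<bar> * \<bar>w \<bullet> v\<bar> = \<bar>w \<bullet> y - w \<bullet> x\<bar>\<close> is
  at most \<open>2 * max \<bar>y\<bar> 1 / M\<close>. So along such a line the directional derivative varies by \<open>O(1 / M)\<close>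
  only, besides being Lipschitz with a fixed constant.

  The estimate splits the difference into three parts: \<open>P\<close> and \<open>Q\<close> contain the factor
  \<open>l * (w \<bullet> v)\<close>, bounded through the width at \<open>y\<close>, and \<open>S\<close> contains \<open>w \<bullet> x\<close>, bounded through the
  width at \<open>x\<close>. The point of smaller norm has to be \<open>x\<close>: the decay of the gradient of
  \<open>1 / (1 + \<bar>z\<bar>\<^sup>2)\<close> on the line is then controlled by its size at \<open>x\<close>, which is what compensates
  the growth of the width.
\<close>

lemma profile_deriv_oscillation_ordered:
  fixes w v x y :: "'a::real_inner"
  assumes w: "norm w = 1" and v: "norm v = 1" and y: "y = x + l *\<^sub>R v"
    and le: "norm x \<le> norm y" and M: "M > 0"
    and Mx: "M * \<bar>w \<bullet> x\<bar> \<le> max (norm x) 1" and My: "M * \<bar>w \<bullet> y\<bar> \<le> max (norm y) 1"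
  shows "\<bar>profile_deriv w y v - profile_deriv w x v\<bar> \<le> 8 * min (1 / M) \<bar>l\<bar>"
proof -
  define a b A B where "a = norm x" and "b = norm y"
    and "A = 1 / (1 + a\<^sup>2)" and "B = 1 / (1 + b\<^sup>2)"
  have a0: "a \<ge> 0" and b0: "b \<ge> 0" and ab: "a \<le> b"
    using le by (auto simp: a_def b_def)
  note bA = inverse_quadratic_bounds[OF a0, folded A_def] and bB = inverse_quadratic_bounds[OF b0, folded B_def]
  have bal: "b - a \<le> \<bar>l\<bar>"
    using norm_triangle_ineq[of x "l *\<^sub>R v"] v by (simp add: a_def b_def y)
  have BA: "B \<le> A" using ab a0 unfolding A_def B_def
    by (intro divide_left_mono) (auto simp: power_mono intro!: mult_pos_pos add_pos_nonneg)
  have AB: "A - B = A * B * (b + a) * (b - a)"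
  proof -
    have "1 + a\<^sup>2 \<noteq> 0" "1 + b\<^sup>2 \<noteq> 0" by (metis add_pos_nonneg less_irrefl zero_le_power2 zero_less_one)+
    then show ?thesis unfolding A_def B_def by (simp add: field_simps power2_eq_square)
  qed
  define t where "t = \<bar>l\<bar> * \<bar>w \<bullet> v\<bar>"
  have wv: "\<bar>w \<bullet> v\<bar> \<le> 1" using Cauchy_Schwarz_ineq2[of w v] w v by simp
  have wx: "\<bar>w \<bullet> x\<bar> \<le> a" using Cauchy_Schwarz_ineq2[of w x] w by (simp add: a_def)
  have xv: "\<bar>x \<bullet> v\<bar> \<le> a" using Cauchy_Schwarz_ineq2[of x v] v by (simp add: a_def)
  have yv: "\<bar>y \<bullet> v\<bar> \<le> b" using Cauchy_Schwarz_ineq2[of y v] v by (simp add: b_def)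
  have t0: "0 \<le> t" and tl: "t \<le> \<bar>l\<bar>" unfolding t_def using wv by (auto intro: mult_left_le)
  have wy: "w \<bullet> y = w \<bullet> x + l * (w \<bullet> v)" by (simp add: y inner_right_distrib)
  have vv: "v \<bullet> v = 1" using v by (simp add: norm_eq_1)
  have yvx: "y \<bullet> v = x \<bullet> v + l" by (simp add: y inner_left_distrib vv)
  have Mt: "M * t \<le> 2 * max b 1"
  proof -
    have "M * t = \<bar>M * (w \<bullet> y) - M * (w \<bullet> x)\<bar>"
      using M by (simp add: t_def wy abs_mult algebra_simps)
    also have "\<dots> \<le> M * \<bar>w \<bullet> y\<bar> + M * \<bar>w \<bullet> x\<bar>"
      using M abs_triangle_ineq4[of "M * (w \<bullet> y)" "M * (w \<bullet> x)"] by (simp add: abs_mult)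
    also have "\<dots> \<le> 2 * max b 1" using Mx My le by (simp add: a_def b_def)
    finally show ?thesis .
  qed
  have AB1: "A - B \<le> 2 * \<bar>l\<bar> * (b * B)"
  proof -
    have "A * B * (b + a) * (b - a) \<le> 1 * B * (2 * b) * \<bar>l\<bar>"
      using bA bB a0 b0 ab bal by (intro mult_mono) auto
    then show ?thesis by (simp add: AB mult_ac)
  qed
  have AB2: "A - B \<le> A * \<bar>l\<bar>"
  proof -
    have "a * B \<le> b * B" using ab bB by (intro mult_right_mono) auto
    then have "B * (b + a) \<le> 1" using bB(3) by (simp add: algebra_simps)
    then have "A * (B * (b + a)) * (b - a) \<le> A * 1 * \<bar>l\<bar>"
      using bA bB a0 b0 ab bal by (intro mult_mono) auto
    then show ?thesis by (simp add: AB mult_ac)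
  qed
  (* P and Q are the terms where w * (y - x) enters; S collects the change of the radial gradient. *)
  define P where "P = (w \<bullet> v) * (A - B)"
  define Q where "Q = 2 * (l * (w \<bullet> v)) * (y \<bullet> v) * B\<^sup>2"
  define S where "S = 2 * (w \<bullet> x) * ((y \<bullet> v) * B\<^sup>2 - (x \<bullet> v) * A\<^sup>2)"
  have nrm: "x \<bullet> x = a\<^sup>2" "y \<bullet> y = b\<^sup>2" by (simp_all add: a_def b_def power2_norm_eq_inner)
  have split: "profile_deriv w y v - profile_deriv w x v = P + Q + S"
    unfolding profile_deriv_def nrm P_def Q_def S_def A_def B_def wy
    by (simp add: algebra_simps power_divide add_divide_distrib diff_divide_distrib)
  have P: "\<bar>P\<bar> \<le> 2 * t * (b * B)"
  proof -
    have "\<bar>P\<bar> = \<bar>w \<bullet> v\<bar> * (A - B)" using BA by (simp add: P_def abs_mult)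
    also have "\<dots> \<le> \<bar>w \<bullet> v\<bar> * (2 * \<bar>l\<bar> * (b * B))" using AB1 by (intro mult_left_mono) auto
    finally show ?thesis by (simp add: t_def mult_ac)
  qed
  have Q: "\<bar>Q\<bar> \<le> t * B"
  proof -
    have "\<bar>Q\<bar> = t * (2 * (\<bar>y \<bullet> v\<bar> * B)) * B"
      using bB by (simp add: Q_def t_def abs_mult power2_eq_square)
    also have "\<dots> \<le> t * 1 * B"
    proof -
      have "\<bar>y \<bullet> v\<bar> * B \<le> b * B" using yv bB by (intro mult_right_mono) auto
      then have "2 * (\<bar>y \<bullet> v\<bar> * B) \<le> 1" using bB(3) by linarith
      then show ?thesis using t0 bB(1) by (intro mult_right_mono mult_left_mono) auto
    qed
    finally show ?thesis by simp
  qed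
  have S1: "\<bar>(y \<bullet> v) * B\<^sup>2 - (x \<bullet> v) * A\<^sup>2\<bar> \<le> A"
  proof -
    have "\<bar>(y \<bullet> v) * B\<^sup>2\<bar> \<le> b * B * B" using yv bB by (simp add: abs_mult power2_eq_square mult_right_mono)
    also have "\<dots> \<le> 1/2 * A" using bB BA b0 by (intro mult_mono) auto
    finally have 1: "\<bar>(y \<bullet> v) * B\<^sup>2\<bar> \<le> 1/2 * A" .
    have "\<bar>(x \<bullet> v) * A\<^sup>2\<bar> \<le> a * A * A" using xv bA by (simp add: abs_mult power2_eq_square mult_right_mono)
    also have "\<dots> \<le> 1/2 * A" using bA a0 by (intro mult_right_mono) auto
    finally show ?thesis using 1 by linarith
  qed
  have S2: "\<bar>(y \<bullet> v) * B\<^sup>2 - (x \<bullet> v) * A\<^sup>2\<bar> \<le> 2 * A * \<bar>l\<bar>"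
  proof -
    have "\<bar>l * B\<^sup>2\<bar> \<le> \<bar>l\<bar> * A"
    proof -
      have "B * B \<le> A * 1" using bB BA by (intro mult_mono) auto
      then show ?thesis by (simp add: abs_mult power2_eq_square mult_left_mono)
    qed
    moreover have "\<bar>(x \<bullet> v) * (A\<^sup>2 - B\<^sup>2)\<bar> \<le> A * \<bar>l\<bar>"
    proof -
      have "0 \<le> A\<^sup>2 - B\<^sup>2" using BA bB by (simp add: power_mono)
      moreover have "A\<^sup>2 - B\<^sup>2 = (A + B) * (A - B)" by (simp add: power2_eq_square algebra_simps)
      moreover have "(A + B) * (A - B) \<le> (2 * A) * (A * \<bar>l\<bar>)"
        using BA bB AB2 by (intro mult_mono) auto
      ultimately have "\<bar>(x \<bullet> v) * (A\<^sup>2 - B\<^sup>2)\<bar> \<le> a * ((2 * A) * (A * \<bar>l\<bar>))"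
        using xv a0 unfolding abs_mult by (intro mult_mono) auto
      also have "\<dots> = (2 * (a * A)) * (A * \<bar>l\<bar>)" by simp
      also have "\<dots> \<le> 1 * (A * \<bar>l\<bar>)" using bA by (intro mult_right_mono) auto
      finally show ?thesis by simp
    qed
    moreover have "(y \<bullet> v) * B\<^sup>2 - (x \<bullet> v) * A\<^sup>2 = l * B\<^sup>2 - (x \<bullet> v) * (A\<^sup>2 - B\<^sup>2)"
      by (simp add: yvx algebra_simps)
    ultimately show ?thesis by (simp add: mult_ac) 
  qed
  have "\<bar>P + Q + S\<bar> \<le> 8 * \<bar>l\<bar>"
  proof -
    have "2 * t * (b * B) \<le> t * 1" using t0 bB(3) mult_left_mono[of "2 * (b*B)" 1 t] by (simp add: mult_ac)
    moreover have "t * B \<le> t" using t0 bB by (simp add: mult_left_le)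
    moreover have "\<bar>S\<bar> \<le> 2 * \<bar>l\<bar>"
    proof -
      have "\<bar>S\<bar> \<le> 2 * a * (2 * A * \<bar>l\<bar>)"
        unfolding S_def abs_mult using S2 wx a0 by (intro mult_mono) auto
      also have "\<dots> = 2 * (2 * (a * A)) * \<bar>l\<bar>" by simp
      also have "\<dots> \<le> 2 * 1 * \<bar>l\<bar>" using bA by (intro mult_right_mono mult_left_mono) auto
      finally show ?thesis by simp
    qed
    ultimately show ?thesis using P Q tl by linarith
  qed
  moreover have "M * \<bar>P + Q + S\<bar> \<le> 8"
  proof -
    have "M * \<bar>P\<bar> \<le> (M * t) * (2 * (b * B))" using mult_left_mono[OF P, of M] M by (simp add: mult_ac)
    also have "\<dots> \<le> (2 * max b 1) * (2 * (b * B))" using Mt b0 bB(1) by (intro mult_right_mono) auto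
    also have "\<dots> \<le> 4" using bB(5) by simp
    finally have 1: "M * \<bar>P\<bar> \<le> 4" .
    have "M * \<bar>Q\<bar> \<le> (M * t) * B" using mult_left_mono[OF Q, of M] M by (simp add: mult_ac)
    also have "\<dots> \<le> (2 * max b 1) * B" using Mt bB(1) by (intro mult_right_mono) auto
    also have "\<dots> \<le> 2" using bB(4) by simp
    finally have 2: "M * \<bar>Q\<bar> \<le> 2" .
    have "M * \<bar>S\<bar> = 2 * (M * \<bar>w \<bullet> x\<bar>) * \<bar>(y \<bullet> v) * B\<^sup>2 - (x \<bullet> v) * A\<^sup>2\<bar>"
      using M by (simp add: S_def abs_mult)
    also have "\<dots> \<le> 2 * max a 1 * A"
      using S1 Mx M a0 unfolding a_def[symmetric] by (intro mult_mono) auto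
    also have "\<dots> \<le> 2" using bA(4) by simp
    finally have 3: "M * \<bar>S\<bar> \<le> 2" .
    have "M * \<bar>P + Q + S\<bar> \<le> M * (\<bar>P\<bar> + \<bar>Q\<bar> + \<bar>S\<bar>)" using M by (intro mult_left_mono) auto
    then show ?thesis using 1 2 3 by (simp add: distrib_left)
  qed
  then have "\<bar>P + Q + S\<bar> \<le> 8 * (1 / M)" using M by (simp add: field_simps)
  ultimately show ?thesis unfolding split by linarith
qed

lemma profile_deriv_oscillation:
  fixes w v x y :: "'a::real_inner"
  assumes w: "norm w = 1" and v: "norm v = 1" and y: "y = x + l *\<^sub>R v" and M: "M > 0"
    and Mx: "M * \<bar>w \<bullet> x\<bar> \<le> max (norm x) 1" and My: "M * \<bar>w \<bullet> y\<bar> \<le> max (norm y) 1"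
  shows "\<bar>profile_deriv w y v - profile_deriv w x v\<bar> \<le> 8 * min (1 / M) \<bar>l\<bar>"
proof (cases "norm x \<le> norm y")
  case True
  then show ?thesis by (rule profile_deriv_oscillation_ordered[OF w v y _ M Mx My])
next
  case False
  have "x = y + (-l) *\<^sub>R v" by (simp add: y)
  from profile_deriv_oscillation_ordered[OF w v this _ M My Mx] False
  show ?thesis by (simp add: abs_minus_commute)
qed

lemma min_le_powr_interpolation:
  fixes p q \<alpha> :: real
  assumes "0 < p" "0 \<le> q" "0 < \<alpha>" "\<alpha> < 1"
  shows "min p q \<le> p powr (1 - \<alpha>) * q powr \<alpha>"
proof -
  have "min p q = min p q powr (1 - \<alpha>) * min p q powr \<alpha>"
    using assms by (simp flip: powr_add)
  also have "\<dots> \<le> p powr (1 - \<alpha>) * q powr \<alpha>"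
    using assms by (intro mult_mono powr_mono2) auto
  finally show ?thesis .
qed

text \<open>
  Rescaling by \<open>R\<close> and interpolating between the two bounds \<open>1 / M\<close> and \<open>\<bar>l\<bar> / R\<close> gives a layer
  whose directional Hoelder constant is smaller, by the factor \<open>M powr (\<alpha> - 1)\<close>, than the natural
  size \<open>R powr (- \<alpha>)\<close> of the Hoelder constant of its full derivative.
\<close>

lemma profile_deriv_Hoelder:
  fixes w v x y :: "'a::real_inner"
  assumes w: "norm w = 1" and v: "norm v = 1" and y: "y = x + l *\<^sub>R v"
    and M: "M > 0" and R: "R > 0" and \<alpha>: "0 < \<alpha>" "\<alpha> < 1"
    and Mx: "M * \<bar>w \<bullet> x\<bar> \<le> max (norm x) R" and My: "M * \<bar>w \<bullet> y\<bar> \<le> max (norm y) R"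
  shows "R powr \<alpha> * \<bar>profile_deriv w (y /\<^sub>R R) v - profile_deriv w (x /\<^sub>R R) v\<bar>
           \<le> 8 * M powr (\<alpha> - 1) * \<bar>l\<bar> powr \<alpha>"
proof -
  have scale: "M * \<bar>w \<bullet> (z /\<^sub>R R)\<bar> \<le> max (norm (z /\<^sub>R R)) 1" if "M * \<bar>w \<bullet> z\<bar> \<le> max (norm z) R" for z
    using that R by (auto simp: field_simps abs_mult max_def split: if_splits)
  have yR: "y /\<^sub>R R = x /\<^sub>R R + (l / R) *\<^sub>R v"
    by (simp add: y scaleR_right_distrib divide_inverse mult.commute)
  have "R powr \<alpha> * \<bar>profile_deriv w (y /\<^sub>R R) v - profile_deriv w (x /\<^sub>R R) v\<bar>
      \<le> R powr \<alpha> * (8 * min (1 / M) \<bar>l / R\<bar>)"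
    using profile_deriv_oscillation[OF w v yR M scale[OF Mx] scale[OF My]] by (intro mult_left_mono) auto
  also have "\<dots> \<le> R powr \<alpha> * (8 * ((1 / M) powr (1 - \<alpha>) * \<bar>l / R\<bar> powr \<alpha>))"
    using min_le_powr_interpolation[of "1 / M" "\<bar>l / R\<bar>" \<alpha>] M \<alpha> by (intro mult_left_mono) auto
  also have "\<dots> = 8 * M powr (\<alpha> - 1) * \<bar>l\<bar> powr \<alpha>"
  proof -
    have "(1 / M) powr (1 - \<alpha>) = M powr (\<alpha> - 1)"
      using M by (simp add: powr_divide powr_minus_divide[symmetric])
    moreover have "\<bar>l / R\<bar> powr \<alpha> = \<bar>l\<bar> powr \<alpha> / R powr \<alpha>"
      using R by (simp add: abs_divide powr_divide)
    ultimately show ?thesis using R by simp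
  qed
  finally show ?thesis .
qed

section \<open>Superposition of layers\<close>

text \<open>
  The layers depend on \<open>x\<close> through \<open>w \<bullet> x\<close> and \<open>s = \<bar>x\<bar>\<^sup>2\<close> only, so that the series to be
  differentiated is one of real functions of \<open>s\<close>, with derivatives bounded uniformly. The point
  \<open>s = 0\<close> has to be an interior point, so the uniform bound is taken on \<open>s > -1/2\<close>, where
  \<open>(R k)\<^sup>2 + s \<ge> (R k)\<^sup>2 / 2\<close>.
\<close>

lemma saturating_series_termwise_derivative:
  fixes c R :: "nat \<Rightarrow> real"
  assumes c: "\<And>k. c k \<ge> 0" and R: "\<And>k. R k \<ge> 1" and sm: "summable (\<lambda>k. c k / (R k)\<^sup>2)"
  shows "\<And>s. s \<ge> 0 \<Longrightarrow> summable (\<lambda>k. c k * (s / ((R k)\<^sup>2 + s)))"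
    and "\<And>s. s \<ge> 0 \<Longrightarrow> summable (\<lambda>k. c k * (R k)\<^sup>2 / ((R k)\<^sup>2 + s)\<^sup>2)"
    and "\<And>s. s \<ge> 0 \<Longrightarrow> ((\<lambda>s. \<Sum>k. c k * (s / ((R k)\<^sup>2 + s))) has_real_derivative
           (\<Sum>k. c k * (R k)\<^sup>2 / ((R k)\<^sup>2 + s)\<^sup>2)) (at s)"
proof -
  have half: "(R k)\<^sup>2 + s \<ge> (R k)\<^sup>2 / 2" "(R k)\<^sup>2 + s > 0" if "s > - 1 / 2" for k s
  proof -
    have "(R k)\<^sup>2 \<ge> 1" using R[of k] by simp
    then show "(R k)\<^sup>2 + s \<ge> (R k)\<^sup>2 / 2" "(R k)\<^sup>2 + s > 0" using that by linarith+
  qed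
  have bound: "norm (c k * (R k)\<^sup>2 / ((R k)\<^sup>2 + s)\<^sup>2) \<le> 4 * (c k / (R k)\<^sup>2)" if "s > - 1 / 2" for k s
  proof -
    have R2: "(R k)\<^sup>2 > 0" using R[of k] by (intro zero_less_power) linarith
    have "((R k)\<^sup>2 / 2)\<^sup>2 \<le> ((R k)\<^sup>2 + s)\<^sup>2" using half[OF that, of k] R2 by (intro power_mono) auto
    then have "c k * (R k)\<^sup>2 / ((R k)\<^sup>2 + s)\<^sup>2 \<le> c k * (R k)\<^sup>2 / ((R k)\<^sup>2 / 2)\<^sup>2"
      using c[of k] R2 half[OF that, of k] by (intro divide_left_mono) auto
    also have "\<dots> = 4 * (c k / (R k)\<^sup>2)" using R2 by (simp add: power2_eq_square)
    finally show ?thesis using c[of k] by simp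
  qed
  have sm4: "summable (\<lambda>k. 4 * (c k / (R k)\<^sup>2))" using sm by (rule summable_mult)
  let ?S = "{- 1 / 2 :: real <..}"
  have unif: "uniformly_convergent_on ?S (\<lambda>n s. \<Sum>k<n. c k * (R k)\<^sup>2 / ((R k)\<^sup>2 + s)\<^sup>2)"
    by (rule Weierstrass_m_test'[OF bound sm4]) auto
  have der: "((\<lambda>s. c k * (s / ((R k)\<^sup>2 + s))) has_real_derivative c k * (R k)\<^sup>2 / ((R k)\<^sup>2 + s)\<^sup>2) (at s within ?S)"
    if "s \<in> ?S" for k s
  proof -
    have "(R k)\<^sup>2 + s \<noteq> 0" using half[of s k] that by simp
    then show ?thesis
      by (auto intro!: derivative_eq_intros simp: power2_eq_square algebra_simps)
  qed
  have sm0: "summable (\<lambda>k. c k * (0 / ((R k)\<^sup>2 + 0)))" by simp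
  have zero: "0 \<in> ?S" by simp
  fix s :: real assume s: "s \<ge> 0"
  then have int: "s \<in> interior ?S" by (simp add: interior_open)
  note * = has_field_derivative_series'[OF _ der unif zero sm0 int]
  show "summable (\<lambda>k. c k * (s / ((R k)\<^sup>2 + s)))" by (rule *(1)) auto
  show "((\<lambda>s. \<Sum>k. c k * (s / ((R k)\<^sup>2 + s))) has_real_derivative
           (\<Sum>k. c k * (R k)\<^sup>2 / ((R k)\<^sup>2 + s)\<^sup>2)) (at s)" by (rule *(2)) auto
  show "summable (\<lambda>k. c k * (R k)\<^sup>2 / ((R k)\<^sup>2 + s)\<^sup>2)"
    by (rule summable_comparison_test'[OF sm4 bound]) (use s in auto)
qed

text \<open>
  With \<open>F\<close> the profile differentiated by \<^const>\<open>profile_deriv\<close>, this is the sum of the rescaled layers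
  \<open>c k * R k * F (x / R k)\<close>.
\<close>

definition layered :: "(nat \<Rightarrow> real) \<Rightarrow> (nat \<Rightarrow> real) \<Rightarrow> 'a::real_inner \<Rightarrow> 'a \<Rightarrow> real"
  where "layered c R w x = (w \<bullet> x) * (\<Sum>k. c k * ((x \<bullet> x) / ((R k)\<^sup>2 + x \<bullet> x)))"

lemma layered_has_derivative:
  fixes w x :: "'a::real_inner"
  assumes c: "\<And>k. c k \<ge> 0" and R: "\<And>k. R k \<ge> 1" and sm: "summable (\<lambda>k. c k / (R k)\<^sup>2)"
  shows "summable (\<lambda>k. c k * profile_deriv w (x /\<^sub>R R k) v)"
    and "(layered c R w has_derivative (\<lambda>v. \<Sum>k. c k * profile_deriv w (x /\<^sub>R R k) v)) (at x)"
proof -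
  note S = saturating_series_termwise_derivative[OF c R sm]
  let ?H = "\<lambda>s. \<Sum>k. c k * (s / ((R k)\<^sup>2 + s))"
  let ?H' = "\<lambda>s. \<Sum>k. c k * (R k)\<^sup>2 / ((R k)\<^sup>2 + s)\<^sup>2"
  have s: "x \<bullet> x \<ge> 0" by simp
  have pd: "c k * profile_deriv w (x /\<^sub>R R k) v = (w \<bullet> v) * (c k * ((x \<bullet> x) / ((R k)\<^sup>2 + x \<bullet> x)))
      + 2 * (w \<bullet> x) * (x \<bullet> v) * (c k * (R k)\<^sup>2 / ((R k)\<^sup>2 + x \<bullet> x)\<^sup>2)" for k v
  proof -
    define s where "s = x \<bullet> x"
    define r where "r = R k"
    have r: "r > 0" using R[of k] by (simp add: r_def)
    have s0: "s \<ge> 0" by (simp add: s_def)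
    have pos: "r\<^sup>2 + s > 0" using r s0 by (simp add: add_pos_nonneg)
    have zz: "(x /\<^sub>R r) \<bullet> (x /\<^sub>R r) = s / r\<^sup>2" by (simp add: s_def divide_inverse power2_eq_square)
    have q: "1 / (1 + s / r\<^sup>2) = r\<^sup>2 / (r\<^sup>2 + s)" using r pos by (simp add: field_simps)
    have 1: "1 - r\<^sup>2 / (r\<^sup>2 + s) = s / (r\<^sup>2 + s)" using pos by (simp add: field_simps)
    have 2: "2 * (w \<bullet> (x /\<^sub>R r)) * ((x /\<^sub>R r) \<bullet> v) / (1 + s / r\<^sup>2)\<^sup>2
        = 2 * (w \<bullet> x) * (x \<bullet> v) * (r\<^sup>2 / (r\<^sup>2 + s)\<^sup>2)"
    proof -
      have "2 * (w \<bullet> (x /\<^sub>R r)) * ((x /\<^sub>R r) \<bullet> v) / (1 + s / r\<^sup>2)\<^sup>2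
          = 2 * (w \<bullet> x) * (x \<bullet> v) / r\<^sup>2 * (1 / (1 + s / r\<^sup>2))\<^sup>2"
        by (simp add: divide_inverse power2_eq_square mult_ac)
      also have "\<dots> = 2 * (w \<bullet> x) * (x \<bullet> v) * (r\<^sup>2 / (r\<^sup>2 + s)\<^sup>2)"
        unfolding q using r by (simp add: power2_eq_square)
      finally show ?thesis .
    qed
    have "profile_deriv w (x /\<^sub>R r) v
        = (w \<bullet> v) * (s / (r\<^sup>2 + s)) + 2 * (w \<bullet> x) * (x \<bullet> v) * (r\<^sup>2 / (r\<^sup>2 + s)\<^sup>2)"
      unfolding profile_deriv_def zz 2 by (simp only: q 1)
    then show ?thesis unfolding s_def[symmetric] r_def[symmetric]
      by (simp add: algebra_simps)
  qed
  have sums: "(\<lambda>k. c k * profile_deriv w (x /\<^sub>R R k) v) sums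
      ((w \<bullet> v) * ?H (x \<bullet> x) + 2 * (w \<bullet> x) * (x \<bullet> v) * ?H' (x \<bullet> x))" for v
    unfolding pd by (intro sums_add sums_mult summable_sums S s)
  then show "summable (\<lambda>k. c k * profile_deriv w (x /\<^sub>R R k) v)" by (rule sums_summable)
  have "((\<lambda>x. ?H (x \<bullet> x)) has_derivative (\<lambda>v. (2 * (x \<bullet> v)) * ?H' (x \<bullet> x))) (at x)"
  proof -
    have "((\<lambda>x. x \<bullet> x) has_derivative (\<lambda>v. 2 * (x \<bullet> v))) (at x)"
      by (auto intro!: derivative_eq_intros simp: inner_commute)
    from has_derivative_compose[OF this S(3)[OF s, unfolded has_field_derivative_def]]
    show ?thesis by (simp add: mult.commute)
  qed
  then have "((\<lambda>x. (w \<bullet> x) * ?H (x \<bullet> x)) has_derivative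
      (\<lambda>v. (w \<bullet> x) * ((2 * (x \<bullet> v)) * ?H' (x \<bullet> x)) + (w \<bullet> v) * ?H (x \<bullet> x))) (at x)"
    by (intro has_derivative_mult bounded_linear.has_derivative[OF bounded_linear_inner_right] has_derivative_ident)
  moreover have "(\<lambda>v. (w \<bullet> x) * ((2 * (x \<bullet> v)) * ?H' (x \<bullet> x)) + (w \<bullet> v) * ?H (x \<bullet> x))
      = (\<lambda>v. \<Sum>k. c k * profile_deriv w (x /\<^sub>R R k) v)"
    using sums by (auto simp: fun_eq_iff sums_iff)
  moreover have "layered c R w = (\<lambda>x. (w \<bullet> x) * ?H (x \<bullet> x))"
    by (simp add: layered_def fun_eq_iff)
  ultimately show "(layered c R w has_derivative (\<lambda>v. \<Sum>k. c k * profile_deriv w (x /\<^sub>R R k) v)) (at x)"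
    by simp
qed

text \<open>
  The coefficient \<open>2 ^ k * R k powr \<alpha>\<close> makes the full derivative of layer \<open>k\<close> too large by \<open>2 ^ k\<close> for
  Hoelder continuity on the scale \<open>R k\<close>; the thinness \<open>M k powr (\<alpha> - 1) = 4 powr (- k)\<close> still leaves
  the directional constants summable. The normalisation \<open>1/16\<close> turns the constant \<open>8\<close> of a layer
  into \<open>1/2\<close>, so that the constants add up to exactly \<open>1\<close>.
\<close>

lemma layered_directionally_Hoelder:
  fixes w x v :: "'a::real_inner"
  assumes M: "\<And>k. M k > 0" and R: "\<And>k. R k \<ge> 1" and \<alpha>: "0 < \<alpha>" "\<alpha> < 1"
    and Meq: "\<And>k. M k powr (\<alpha> - 1) = (1 / 4) ^ k"
    and c: "\<And>k. c k = 2 ^ k * R k powr \<alpha> / 16"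
    and sm: "summable (\<lambda>k. c k / (R k)\<^sup>2)"
    and thin: "\<And>k x. x \<in> G \<Longrightarrow> M k * \<bar>w \<bullet> x\<bar> \<le> max (norm x) (R k)"
    and w: "norm w = 1" and v: "norm v = 1" and x: "x \<in> G" and y: "x + l *\<^sub>R v \<in> G"
  shows "\<bar>(\<Sum>k. c k * profile_deriv w ((x + l *\<^sub>R v) /\<^sub>R R k) v)
          - (\<Sum>k. c k * profile_deriv w (x /\<^sub>R R k) v)\<bar> \<le> \<bar>l\<bar> powr \<alpha>"
proof -
  define d where "d k = c k * profile_deriv w ((x + l *\<^sub>R v) /\<^sub>R R k) v - c k * profile_deriv w (x /\<^sub>R R k) v" for k
  have c0: "c k \<ge> 0" for k by (simp add: c)
  note sum = layered_has_derivative(1)[OF c0 R sm]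
  have d: "\<bar>d k\<bar> \<le> (1 / 2) ^ Suc k * \<bar>l\<bar> powr \<alpha>" for k
  proof -
    have R0: "R k > 0" using R[of k] by simp
    have "d k = 2 ^ k / 16 * (R k powr \<alpha> * (profile_deriv w ((x + l *\<^sub>R v) /\<^sub>R R k) v - profile_deriv w (x /\<^sub>R R k) v))"
      by (simp add: d_def c algebra_simps)
    then have "\<bar>d k\<bar> = 2 ^ k / 16 * (R k powr \<alpha> * \<bar>profile_deriv w ((x + l *\<^sub>R v) /\<^sub>R R k) v - profile_deriv w (x /\<^sub>R R k) v\<bar>)"
      by (simp only: abs_mult) simp
    also have "\<dots> \<le> 2 ^ k / 16 * (8 * M k powr (\<alpha> - 1) * \<bar>l\<bar> powr \<alpha>)"
      by (intro mult_left_mono profile_deriv_Hoelder[OF w v refl M R0 \<alpha> thin[OF x] thin[OF y]]) auto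
    also have "\<dots> = (1 / 2) ^ Suc k * \<bar>l\<bar> powr \<alpha>"
    proof -
      have "(2::real) ^ k * (1 / 4) ^ k = (1 / 2) ^ k" by (simp flip: power_mult_distrib)
      then show ?thesis by (simp add: Meq)
    qed
    finally show ?thesis .
  qed
  have half: "(\<lambda>k. (1 / 2) ^ Suc k * \<bar>l\<bar> powr \<alpha>) sums (1 * \<bar>l\<bar> powr \<alpha>)"
    by (intro sums_mult2 power_half_series)
  have "norm (suminf d) \<le> (\<Sum>k. (1 / 2) ^ Suc k * \<bar>l\<bar> powr \<alpha>)"
    by (rule norm_suminf_le) (use d half in \<open>auto simp: sums_iff\<close>)
  also have "\<dots> = \<bar>l\<bar> powr \<alpha>" using half by (simp add: sums_iff)
  finally show ?thesis
    using suminf_diff[OF sum sum, of w "x + l *\<^sub>R v" v w x v] by (simp add: d_def [abs_def])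
qed

section \<open>Consequences for the derivative on the whole set\<close>

text \<open>
  By the mean value theorem the remainder is \<open>\<bar>h\<bar>\<close> times a difference of derivatives in the direction of
  \<open>h\<close>, taken at two points of the segment from \<open>x\<close> to \<open>x + h\<close>.
\<close>

lemma Taylor_remainder_from_directional_Hoelder:
  fixes f :: "'a::real_normed_vector \<Rightarrow> real"
  assumes der: "\<And>x. x \<in> G \<Longrightarrow> (f has_derivative D x) (at x)" and "convex G" and "0 \<le> \<alpha>"
    and dir: "\<And>x v l. x \<in> G \<Longrightarrow> norm v = 1 \<Longrightarrow> x + l *\<^sub>R v \<in> G
               \<Longrightarrow> \<bar>D (x + l *\<^sub>R v) v - D x v\<bar> \<le> \<bar>l\<bar> powr \<alpha>"
    and x: "x \<in> G" "x + h \<in> G"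
  shows "\<bar>f (x + h) - f x - D x h\<bar> \<le> norm h powr (1 + \<alpha>)"
proof (cases "h = 0")
  case True
  then show ?thesis using has_derivative_bounded_linear[OF der[OF x(1)]]
    by (simp add: linear_simps)
next
  case False
  define v where "v = h /\<^sub>R norm h"
  have v: "norm v = 1" and h: "h = norm h *\<^sub>R v" using False by (auto simp: v_def)
  have inG: "x + t *\<^sub>R v \<in> G" if "0 \<le> t" "t \<le> norm h" for t
  proof -
    have "(1 - t / norm h) *\<^sub>R x + (t / norm h) *\<^sub>R (x + h) \<in> G"
      by (rule convexD[OF \<open>convex G\<close> x]) (use that False in \<open>auto simp: field_simps\<close>)
    then show ?thesis by (simp add: v_def algebra_simps divide_inverse)
  qed
  have "((\<lambda>t. f (x + t *\<^sub>R v)) has_real_derivative D (x + t *\<^sub>R v) v) (at t)"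
    if "0 \<le> t" "t \<le> norm h" for t
  proof -
    have "((\<lambda>t. x + t *\<^sub>R v) has_derivative (\<lambda>t. t *\<^sub>R v)) (at t)"
      by (auto intro!: derivative_eq_intros)
    from has_derivative_compose[OF this der[OF inG[OF that]]]
    show ?thesis
      using linear_cmul[OF has_derivative_linear[OF der[OF inG[OF that]]]]
      by (simp add: has_field_derivative_def mult.commute[of _ "D (x + t *\<^sub>R v) v"] fun_eq_iff)
  qed
  then obtain z where z: "0 < z" "z < norm h"
    "f (x + norm h *\<^sub>R v) - f (x + 0 *\<^sub>R v) = (norm h - 0) * D (x + z *\<^sub>R v) v"
    using MVT2[of 0 "norm h" "\<lambda>t. f (x + t *\<^sub>R v)" "\<lambda>t. D (x + t *\<^sub>R v) v"] False by auto
  have "D x h = norm h * D x v"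
    using linear_cmul[OF has_derivative_linear[OF der[OF x(1)]], of "norm h" v] h by simp
  with z(3) h have "f (x + h) - f x - D x h = norm h * (D (x + z *\<^sub>R v) v - D x v)"
    by (simp add: algebra_simps)
  then have "\<bar>f (x + h) - f x - D x h\<bar> = norm h * \<bar>D (x + z *\<^sub>R v) v - D x v\<bar>"
    by (simp add: abs_mult)
  also have "\<dots> \<le> norm h * \<bar>z\<bar> powr \<alpha>"
    using dir[OF x(1) v inG[of z]] z by (intro mult_left_mono) auto
  also have "\<dots> \<le> norm h * norm h powr \<alpha>"
    using z \<open>0 \<le> \<alpha>\<close> by (intro mult_left_mono powr_mono2) auto
  also have "\<dots> = norm h powr (1 + \<alpha>)" using False by (simp add: powr_add)
  finally show ?thesis .
qed

lemma convex_unbounded_meets_sphere: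
  fixes G :: "'a::real_normed_vector set"
  assumes "convex G" "\<not> bounded G" "a \<in> G" "norm a \<le> r"
  obtains x where "x \<in> G" "norm x = r"
proof -
  obtain y where y: "y \<in> G" "norm y > r"
    using assms(2) unfolding bounded_iff by (meson not_le)
  have "connected (norm ` G)"
    by (intro connected_continuous_image continuous_intros convex_connected assms)
  then have "r \<in> norm ` G"
    using connectedD_interval[of "norm ` G" "norm a" "norm y" r] y assms by auto
  then show ?thesis using that by auto
qed

text \<open>
  In direction \<open>w\<close> no layer has a negative derivative, so the layers cannot cancel: at a point of
  norm \<open>R k\<close> layer \<open>k\<close> alone contributes at least \<open>c k / 2\<close>. A convex unbounded set has points of every
  large norm, and the distance of such a point from a fixed one is at most \<open>2 * R k\<close>. Hence a Hoelder
  bound would force \<open>c k = O(R k powr \<alpha>)\<close>.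
\<close>

lemma layered_not_C1_Hoelder:
  fixes G :: "'a::euclidean_space set"
  assumes c: "\<And>k. c k \<ge> 0" and R: "\<And>k. R k \<ge> 1" and sm: "summable (\<lambda>k. c k / (R k)\<^sup>2)"
    and w: "norm w = 1" and G: "convex G" "\<not> bounded G" and \<alpha>: "0 < \<alpha>" "\<alpha> < 1"
    and unb: "filterlim R at_top sequentially"
    and fast: "filterlim (\<lambda>k. c k / R k powr \<alpha>) at_top sequentially"
  shows "layered c R w \<notin> C1_Holder \<alpha> G"
proof
  define D where "D = (\<lambda>x v. \<Sum>k. c k * profile_deriv w (x /\<^sub>R R k) v)"
  have der: "(layered c R w has_derivative D x) (at x)" for x
    unfolding D_def by (rule layered_has_derivative(2)[OF c R sm])
  have fd: "frechet_derivative (layered c R w) (at x) = D x" for x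
    using frechet_derivative_at[OF der] by simp
  assume "layered c R w \<in> C1_Holder \<alpha> G"
  then obtain C where C: "C > 0" "\<And>x y. x \<in> G \<Longrightarrow> y \<in> G \<Longrightarrow>
      onorm (\<lambda>h. D x h - D y h) \<le> C * norm (x - y) powr \<alpha>"
    unfolding C1_Holder_def mem_Collect_eq fd by blast
  have lower: "c k / 2 \<le> D x w" if "norm x = R k" for x k
  proof -
    have nn: "0 \<le> profile_deriv w z w" and
         ge: "1 - 1 / (1 + z \<bullet> z) \<le> profile_deriv w z w" for z
    proof -
      have "w \<bullet> w = 1" using w by (simp add: norm_eq_1)
      then have "profile_deriv w z w = 1 - 1 / (1 + z \<bullet> z) + 2 * (w \<bullet> z)\<^sup>2 / (1 + z \<bullet> z)\<^sup>2"
        by (simp add: profile_deriv_def power2_eq_square inner_commute)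
      then show "1 - 1 / (1 + z \<bullet> z) \<le> profile_deriv w z w" by simp
      moreover have "1 / (1 + z \<bullet> z) \<le> 1"
        using inner_ge_zero[of z] by (subst pos_divide_le_eq) (linarith, simp)
      ultimately show "0 \<le> profile_deriv w z w" by linarith
    qed
    have "norm (x /\<^sub>R R k) = 1" using that R[of k] by simp
    then have "(x /\<^sub>R R k) \<bullet> (x /\<^sub>R R k) = 1" unfolding norm_eq_1 .
    then have "1 / 2 \<le> profile_deriv w (x /\<^sub>R R k) w" using ge[of "x /\<^sub>R R k"] by simp
    then have "c k * (1 / 2) \<le> c k * profile_deriv w (x /\<^sub>R R k) w" using c by (intro mult_left_mono) auto
    also have "\<dots> = (\<Sum>j\<in>{k}. c j * profile_deriv w (x /\<^sub>R R j) w)" by simp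
    also have "\<dots> \<le> D x w" unfolding D_def
      by (rule sum_le_suminf[OF layered_has_derivative(1)[OF c R sm]]) (auto intro: mult_nonneg_nonneg c nn)
    finally show ?thesis by simp
  qed
  have "G \<noteq> {}" using G by auto
  then obtain a where a: "a \<in> G" by blast
  have "\<forall>\<^sub>F k in sequentially. R k \<ge> norm a" using unb unfolding filterlim_at_top by blast
  moreover have "\<forall>\<^sub>F k in sequentially. c k / R k powr \<alpha> \<ge> 2 * \<bar>D a w\<bar> + 4 * C + 1"
    using fast unfolding filterlim_at_top by blast
  ultimately have "\<forall>\<^sub>F k in sequentially. False"
  proof eventually_elim
    case (elim k)
    obtain x where x: "x \<in> G" "norm x = R k"
      using convex_unbounded_meets_sphere[OF G a elim(1)] by blast
    have Rp: "R k powr \<alpha> \<ge> 1" using R[of k] \<alpha> by (simp add: ge_one_powr_ge_zero)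
    have "bounded_linear (\<lambda>h. D x h - D a h)"
      using der[THEN has_derivative_bounded_linear] by (intro bounded_linear_sub)
    then have "norm (D x w - D a w) \<le> onorm (\<lambda>h. D x h - D a h) * norm w" by (rule onorm)
    also have "\<dots> \<le> C * norm (x - a) powr \<alpha>" using C(2)[OF x(1) a] w by simp
    also have "\<dots> \<le> C * (2 * R k) powr \<alpha>"
      using C(1) \<alpha> norm_triangle_ineq4[of x a] x elim(1) by (intro mult_left_mono powr_mono2) auto
    also have "\<dots> \<le> C * (2 * R k powr \<alpha>)"
    proof -
      have "2 powr \<alpha> \<le> (2::real) powr 1" using \<alpha> by (intro powr_mono) auto
      then show ?thesis using C(1) R[of k] by (simp add: powr_mult mult_right_mono)
    qed
    finally have "D x w \<le> \<bar>D a w\<bar> * 1 + 2 * C * R k powr \<alpha>" by simp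
    also have "\<dots> \<le> \<bar>D a w\<bar> * R k powr \<alpha> + 2 * C * R k powr \<alpha>"
      using Rp by (intro add_right_mono mult_left_mono) auto
    finally have "c k \<le> (2 * \<bar>D a w\<bar> + 4 * C) * R k powr \<alpha>"
      using lower[OF x(2)] by (simp add: algebra_simps)
    moreover have "(2 * \<bar>D a w\<bar> + 4 * C + 1) * R k powr \<alpha> \<le> c k"
      using elim(2) Rp by (subst (asm) pos_le_divide_eq) linarith+
    ultimately show False using Rp by (simp add: algebra_simps)
  qed
  then show False by simp
qed

section \<open>The counterexample\<close>

theorem corollary1p2:
  fixes G :: "(real ^ 'n) set" and \<alpha> :: real and \<omega> :: "real \<Rightarrow> real"
  assumes "CARD('n) \<ge> 2"
    and "\<not> bounded G" and "open G" and "convex G"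
    and "\<not> contains_translated_fat_cone G"
    and "0 < \<alpha>" and "\<alpha> < 1"
    and "\<And>t. t \<ge> 0 \<Longrightarrow> \<omega> t = t powr \<alpha>"
  shows "\<exists>f :: real ^ 'n \<Rightarrow> real.
    (\<forall>x\<in>G. f differentiable at x) \<and>
    (\<forall>a\<in>G. \<forall>v. norm v = 1 \<longrightarrow>
       uniformly_continuous_with_modulus \<omega> {t. a + t *\<^sub>R v \<in> G}
         (deriv (\<lambda>t. f (a + t *\<^sub>R v)))) \<and>
    (\<forall>x h. x \<in> G \<and> x + h \<in> G \<longrightarrow>
       \<bar>f (x + h) - f x - frechet_derivative f (at x) h\<bar> \<le> norm h powr (1 + \<alpha>)) \<and>
    f \<notin> C1_Holder \<alpha> G"
proof -
  note \<alpha> = \<open>0 < \<alpha>\<close> \<open>\<alpha> < 1\<close>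
  have "G \<noteq> {}" using \<open>\<not> bounded G\<close> by auto
  then obtain w where w: "norm w = 1" and
    thin0: "\<And>M::real. \<exists>R. \<forall>x\<in>G. M * \<bar>w \<bullet> x\<bar> \<le> max (norm x) R"
    using thin_direction assms by blast
  define M where "M k = 4 powr (real k / (1 - \<alpha>))" for k :: nat
  have M: "M k > 0" for k by (simp add: M_def)
  have Meq: "M k powr (\<alpha> - 1) = (1 / 4) ^ k" for k
  proof -
    have "M k powr (\<alpha> - 1) = 4 powr (- real k)"
    proof -
      have "real k / (1 - \<alpha>) * (\<alpha> - 1) = - real k" using \<alpha> by (simp add: field_simps)
      then show ?thesis by (simp add: M_def powr_powr)
    qed
    then show ?thesis by (simp add: powr_minus powr_realpow power_one_over inverse_eq_divide)
  qed
  from thin0 have "\<forall>k. \<exists>r. \<forall>x\<in>G. M k * \<bar>w \<bullet> x\<bar> \<le> max (norm x) r" by blast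
  from choice[OF this] obtain R0 where
    R0: "\<And>k x. x \<in> G \<Longrightarrow> M k * \<bar>w \<bullet> x\<bar> \<le> max (norm x) (R0 k)"
    by blast
  (* The growth of R makes the series of layers converge: c k / (R k)^2 <= 2^k / R k <= 2^(-k). *)
  define R where "R k = max (R0 k) (4 ^ k)" for k
  have R4: "R k \<ge> 4 ^ k" for k by (simp add: R_def)
  have R: "R k \<ge> 1" for k
  proof -
    have "(1::real) \<le> 4 ^ k" by simp
    with R4[of k] show ?thesis by linarith
  qed
  have thin: "M k * \<bar>w \<bullet> x\<bar> \<le> max (norm x) (R k)" if "x \<in> G" for k x
    using R0[OF that, of k] by (simp add: R_def max_def split: if_splits)
  define c where "c k = 2 ^ k * R k powr \<alpha> / 16" for k
  have c0: "c k \<ge> 0" for k by (simp add: c_def)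
  have sm: "summable (\<lambda>k. c k / (R k)\<^sup>2)"
  proof (rule summable_comparison_test')
    show "summable (\<lambda>k. (1 / 2 :: real) ^ k)" by (simp add: summable_geometric)
    fix k :: nat
    have R1: "R k > 0" using R[of k] by simp
    have "R k powr \<alpha> \<le> R k" using powr_mono[of \<alpha> 1 "R k"] R[of k] \<alpha> by simp
    then have "c k \<le> 2 ^ k * R k" unfolding c_def using R1 by (simp add: field_simps)
    moreover have "2 ^ k * 2 ^ k \<le> R k" using R4[of k] by (simp flip: power_mult_distrib)
    then have "2 ^ k * R k \<le> (1/2) ^ k * (R k)\<^sup>2" using R1 by (simp add: power2_eq_square field_simps)
    ultimately have "c k \<le> (1/2) ^ k * (R k)\<^sup>2" by linarith
    then show "norm (c k / (R k)\<^sup>2) \<le> (1 / 2) ^ k"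
      using R1 c0[of k] by (simp add: pos_divide_le_eq)
  qed
  have pow_top: "filterlim (\<lambda>k. b ^ k) at_top sequentially" if "b > 1" for b :: real
    using filterlim_at_infinity_imp_norm_at_top[OF filterlim_realpow_sequentially_gt1[of b]] that
    by (simp add: norm_power)
  have unb: "filterlim R at_top sequentially"
    by (rule filterlim_at_top_mono[OF pow_top[of 4]]) (use R4 in auto)
  have fast: "filterlim (\<lambda>k. c k / R k powr \<alpha>) at_top sequentially"
  proof -
    have "(\<lambda>k. c k / R k powr \<alpha>) = (\<lambda>k. (1 / 16) * 2 ^ k)"
    proof
      fix k
      show "c k / R k powr \<alpha> = (1 / 16) * 2 ^ k" using R[of k] by (simp add: c_def)
    qed
    moreover have "filterlim (\<lambda>k. (1 / 16) * (2::real) ^ k) at_top sequentially"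
      by (rule filterlim_tendsto_pos_mult_at_top[OF tendsto_const _ pow_top]) auto
    ultimately show ?thesis by (simp only:)
  qed
  define f where "f = layered c R w"
  define D where "D = (\<lambda>x v. \<Sum>k. c k * profile_deriv w (x /\<^sub>R R k) v)"
  have der: "(f has_derivative D x) (at x)" for x
    unfolding D_def f_def by (rule layered_has_derivative(2)[OF c0 R sm])
  have fd: "frechet_derivative f (at x) = D x" for x
    using frechet_derivative_at[OF der] by simp
  have dir: "\<bar>D (x + l *\<^sub>R v) v - D x v\<bar> \<le> \<bar>l\<bar> powr \<alpha>"
    if "x \<in> G" "norm v = 1" "x + l *\<^sub>R v \<in> G" for x v l
    unfolding D_def by (rule layered_directionally_Hoelder[OF M R \<alpha> Meq c_def sm thin w that(2,1,3)])
  show ?thesis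
  proof (intro exI[of _ f] conjI ballI allI impI)
    show "f differentiable at x" for x
      using der differentiable_def by blast
  next
    fix a v :: "real ^ 'n" assume v: "norm v = 1"
    have dv: "deriv (\<lambda>t. f (a + t *\<^sub>R v)) t = D (a + t *\<^sub>R v) v" for t
    proof (rule DERIV_imp_deriv)
      have "((\<lambda>t. a + t *\<^sub>R v) has_derivative (\<lambda>t. t *\<^sub>R v)) (at t)"
        by (auto intro!: derivative_eq_intros)
      from has_derivative_compose[OF this der]
      show "((\<lambda>t. f (a + t *\<^sub>R v)) has_real_derivative D (a + t *\<^sub>R v) v) (at t)"
        using linear_cmul[OF has_derivative_linear[OF der]]
        by (simp add: has_field_derivative_def mult.commute[of _ "D (a + t *\<^sub>R v) v"] fun_eq_iff)
    qed
    show "uniformly_continuous_with_modulus \<omega> {t. a + t *\<^sub>R v \<in> G} (deriv (\<lambda>t. f (a + t *\<^sub>R v)))"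
      unfolding uniformly_continuous_with_modulus_def dv
    proof (intro ballI)
      fix s t assume st: "s \<in> {t. a + t *\<^sub>R v \<in> G}" "t \<in> {t. a + t *\<^sub>R v \<in> G}"
      have eq: "a + t *\<^sub>R v + (s - t) *\<^sub>R v = a + s *\<^sub>R v" by (simp add: algebra_simps)
      show "norm (D (a + s *\<^sub>R v) v - D (a + t *\<^sub>R v) v) \<le> \<omega> (norm (s - t))"
        using dir[of "a + t *\<^sub>R v" v "s - t"] st v assms(8) unfolding eq by simp
    qed
  next
    fix x h :: "real ^ 'n" assume "x \<in> G \<and> x + h \<in> G"
    then show "\<bar>f (x + h) - f x - frechet_derivative f (at x) h\<bar> \<le> norm h powr (1 + \<alpha>)"
      unfolding fd
      by (intro Taylor_remainder_from_directional_Hoelder[where G = G and D = D]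
            der dir \<open>convex G\<close> less_imp_le[OF \<alpha>(1)]) simp_all
  next
    show "f \<notin> C1_Holder \<alpha> G"
      unfolding f_def
      by (rule layered_not_C1_Hoelder[OF c0 R sm w assms(4,2) \<alpha> unb fast])
  qed
qed

end
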